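(* Let $G$ be a Cayley graph of a finite group $\Gamma$ that is nilpotent of class $\le n$, and let $r\ge 2^{n+1}$. If $G$ has an $r$-local cutvertex, then $G$ is a cycle of length greater than $r$ and $\Gamma$ is cyclic.
   Context: A generating set $S$ does not contain the neutral element $\mathbb{I}$ and is closed under inverses; the Cayley graph $\mathrm{Cay}(\Gamma,S)$ is the simple graph on $\Gamma$ with edges $\{g,gs\}$, $g\in\Gamma$, $s\in S$. $a\equiv b$ means $a=b$ or $a=b^{-1}$. Iterated commutators: $[g,h]_1:=gh^{-1}g^{-1}h$, $[g,h]_n$ the reduced form of $g[g,h]_{n-1}^{-1}g^{-1}[g,h]_{n-1}$; $\Gamma$ is nilpotent of class $\le n$ if $[g,h]_n=\mathbb{I}$ for all $g\not\equiv h$ in $\Gamma$. The ball $B_r(v)$ around a vertex $v$ is the subgraph consisting of all vertices and edges on closed walks of length at most $r$ through $v$; $v$ is an $r$-local cutvertex if $B_r(v)-v$ is disconnected. *)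

theory Defs
  imports "HOL-Algebra.Elementary_Groups"
begin

text \<open>iter_comm G k g h is the iterated commutator [g,h]_k. We set [g,h]_0 = h,
  so that [g,h]_1 = g h^-1 g^-1 h and [g,h]_(k+1) = g [g,h]_k^-1 g^-1 [g,h]_k.\<close>
fun iter_comm :: "('a, 'b) monoid_scheme \<Rightarrow> nat \<Rightarrow> 'a \<Rightarrow> 'a \<Rightarrow> 'a" where
  "iter_comm G 0 g h = h"
| "iter_comm G (Suc k) g h =
     g \<otimes>\<^bsub>G\<^esub> inv\<^bsub>G\<^esub> (iter_comm G k g h) \<otimes>\<^bsub>G\<^esub> inv\<^bsub>G\<^esub> g \<otimes>\<^bsub>G\<^esub> iter_comm G k g h"

definition equiv_inv :: "('a, 'b) monoid_scheme \<Rightarrow> 'a \<Rightarrow> 'a \<Rightarrow> bool" where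
  "equiv_inv G a b \<longleftrightarrow> a = b \<or> a = inv\<^bsub>G\<^esub> b"

definition nilpotent_class_le :: "('a, 'b) monoid_scheme \<Rightarrow> nat \<Rightarrow> bool" where
  "nilpotent_class_le G n \<longleftrightarrow>
     (\<forall>g\<in>carrier G. \<forall>h\<in>carrier G. \<not> equiv_inv G g h \<longrightarrow> iter_comm G n g h = \<one>\<^bsub>G\<^esub>)"

definition generating_set :: "('a, 'b) monoid_scheme \<Rightarrow> 'a set \<Rightarrow> bool" where
  "generating_set G S \<longleftrightarrow> S \<subseteq> carrier G \<and> \<one>\<^bsub>G\<^esub> \<notin> S
     \<and> (\<forall>s\<in>S. inv\<^bsub>G\<^esub> s \<in> S) \<and> generate G S = carrier G"

definition cayley_adj :: "('a, 'b) monoid_scheme \<Rightarrow> 'a set \<Rightarrow> 'a \<Rightarrow> 'a \<Rightarrow> bool" where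
  "cayley_adj G S x y \<longleftrightarrow> x \<in> carrier G \<and> y \<in> carrier G \<and>
     ((\<exists>s\<in>S. y = x \<otimes>\<^bsub>G\<^esub> s) \<or> (\<exists>s\<in>S. x = y \<otimes>\<^bsub>G\<^esub> s))"

definition walk :: "'a set \<Rightarrow> ('a \<Rightarrow> 'a \<Rightarrow> bool) \<Rightarrow> 'a list \<Rightarrow> bool" where
  "walk V E xs \<longleftrightarrow> xs \<noteq> [] \<and> set xs \<subseteq> V \<and>
     (\<forall>i. Suc i < length xs \<longrightarrow> E (xs ! i) (xs ! Suc i))"

text \<open>A closed walk of length at most r through v (length = number of edges).\<close>
definition closed_walk_through :: "'a set \<Rightarrow> ('a \<Rightarrow> 'a \<Rightarrow> bool) \<Rightarrow> nat \<Rightarrow> 'a \<Rightarrow> 'a list \<Rightarrow> bool" where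
  "closed_walk_through V E r v xs \<longleftrightarrow> walk V E xs \<and> hd xs = last xs
     \<and> length xs \<le> Suc r \<and> v \<in> set xs"

definition ball_verts :: "'a set \<Rightarrow> ('a \<Rightarrow> 'a \<Rightarrow> bool) \<Rightarrow> nat \<Rightarrow> 'a \<Rightarrow> 'a set" where
  "ball_verts V E r v = {x. \<exists>xs. closed_walk_through V E r v xs \<and> x \<in> set xs}"

definition ball_edge :: "'a set \<Rightarrow> ('a \<Rightarrow> 'a \<Rightarrow> bool) \<Rightarrow> nat \<Rightarrow> 'a \<Rightarrow> 'a \<Rightarrow> 'a \<Rightarrow> bool" where
  "ball_edge V E r v x y \<longleftrightarrow> (\<exists>xs. closed_walk_through V E r v xs \<and>
     (\<exists>i. Suc i < length xs \<and>
        ((xs ! i = x \<and> xs ! Suc i = y) \<or> (xs ! i = y \<and> xs ! Suc i = x))))"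

definition local_cutvertex :: "'a set \<Rightarrow> ('a \<Rightarrow> 'a \<Rightarrow> bool) \<Rightarrow> nat \<Rightarrow> 'a \<Rightarrow> bool" where
  "local_cutvertex V E r v \<longleftrightarrow> v \<in> V \<and>
     (\<exists>a b. a \<in> ball_verts V E r v - {v} \<and> b \<in> ball_verts V E r v - {v} \<and>
        \<not> (\<lambda>x y. ball_edge V E r v x y \<and> x \<noteq> v \<and> y \<noteq> v)\<^sup>*\<^sup>* a b)"

definition is_cycle_graph :: "'a set \<Rightarrow> ('a \<Rightarrow> 'a \<Rightarrow> bool) \<Rightarrow> nat \<Rightarrow> bool" where
  "is_cycle_graph V E m \<longleftrightarrow> m \<ge> 3 \<and> (\<exists>f. bij_betw f {..<m} V \<and>
     (\<forall>x y. E x y \<longleftrightarrow> (\<exists>i<m. (x = f i \<and> y = f (Suc i mod m)) \<or> (y = f i \<and> x = f (Suc i mod m)))))"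

end

theory Submission
  imports Defs "HOL-Algebra.Multiplicative_Group"
begin

text \<open>Call two generators \<open>s\<close>, \<open>t\<close> connected if \<open>v s\<close> and \<open>v t\<close> lie in the same component of the
  punctured ball around \<open>v\<close>. A shortest nonempty trivial subword of a trivial word of length at most
  \<open>r\<close> traces a cycle, and rotating it so that any given corner is at \<open>v\<close> shows that for cyclically
  consecutive letters \<open>x\<close>, \<open>y\<close> the generators \<open>inv x\<close> and \<open>y\<close> are connected. The reduced word of the
  \<open>n\<close>-th iterated commutator of \<open>g\<close> and \<open>h\<close> has length \<open>2 ^ (n + 1)\<close>, its letters alternate between
  \<open>g\<close> and \<open>h\<close>, and among any four consecutive signs two neighbouring ones agree. So if \<open>g\<close>, \<open>h\<close>
  and their inverses were not all connected, such a subword would have at most three letters, and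
  such words are either nontrivial or connect everything. Hence a local cutvertex leaves only
  \<open>S = {s, inv s}\<close> with \<open>s\<close> and \<open>inv s\<close> not connected, which forces the order of \<open>s\<close> to exceed \<open>r\<close>.\<close>

section \<open>Products of words over a group\<close>

context group
begin

primrec wprod :: "'a list \<Rightarrow> 'a" where
  "wprod [] = \<one>"
| "wprod (x # w) = x \<otimes> wprod w"

lemma wprod_closed: "set w \<subseteq> carrier G \<Longrightarrow> wprod w \<in> carrier G"
  by (induction w) auto

lemma wprod_append:
  "set w \<subseteq> carrier G \<Longrightarrow> set w' \<subseteq> carrier G \<Longrightarrow> wprod (w @ w') = wprod w \<otimes> wprod w'"
  by (induction w) (auto simp: wprod_closed m_assoc)

lemma wprod_rev_inv:
  "set w \<subseteq> carrier G \<Longrightarrow> wprod (rev (map (m_inv G) w)) = inv (wprod w)"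
proof (induction w)
  case (Cons x w)
  then have "set (rev (map (m_inv G) w)) \<subseteq> carrier G" by auto
  with Cons show ?case by (auto simp: wprod_append wprod_closed inv_mult_group)
qed auto

lemma wprod_replicate: "s \<in> carrier G \<Longrightarrow> wprod (replicate k s) = s [^] k"
proof (induction k)
  case (Suc k)
  then show ?case using nat_pow_Suc2[of s k] by simp
qed simp

lemma wprod_rotate_eq_one:
  assumes "set p \<subseteq> carrier G" "set q \<subseteq> carrier G" "wprod (p @ q) = \<one>"
  shows "wprod (q @ p) = \<one>"
  using assms by (simp add: wprod_append wprod_closed inv_comm)

end

section \<open>Components of the punctured ball and words tracing cycles\<close>

lemma rtranclp_symmetric:
  assumes "\<And>x y. R x y \<Longrightarrow> R y x" "R\<^sup>*\<^sup>* x y"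
  shows "R\<^sup>*\<^sup>* y x"
  using assms(2) by induction (auto intro: assms(1) converse_rtranclp_into_rtranclp)

lemma ball_edge_commute: "ball_edge V E r v x y \<longleftrightarrow> ball_edge V E r v y x"
  unfolding ball_edge_def by metis

locale cayley_ball = group G for G (structure) +
  fixes S :: "'a set" and r :: nat and v :: 'a
  assumes gens: "generating_set G S" and v_in: "v \<in> carrier G"
begin

definition step :: "'a \<Rightarrow> 'a \<Rightarrow> bool" where
  "step x y \<longleftrightarrow> ball_edge (carrier G) (cayley_adj G S) r v x y \<and> x \<noteq> v \<and> y \<noteq> v"

definition conn :: "'a \<Rightarrow> 'a \<Rightarrow> bool" where
  "conn s t \<longleftrightarrow> step\<^sup>*\<^sup>* (v \<otimes> s) (v \<otimes> t)"

lemma S_carrier: "S \<subseteq> carrier G" and one_notin_S: "\<one> \<notin> S"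
  and S_inv: "s \<in> S \<Longrightarrow> inv s \<in> S" and S_generates: "generate G S = carrier G"
  using gens by (auto simp: generating_set_def)

lemma step_sym: "step\<^sup>*\<^sup>* x y \<Longrightarrow> step\<^sup>*\<^sup>* y x"
  by (rule rtranclp_symmetric) (auto simp: step_def ball_edge_commute)

lemma conn_refl: "conn s s"
  by (simp add: conn_def)

lemma conn_sym: "conn s t \<Longrightarrow> conn t s"
  unfolding conn_def by (rule step_sym)

lemma conn_trans: "conn s t \<Longrightarrow> conn t u \<Longrightarrow> conn s u"
  unfolding conn_def by (rule rtranclp_trans)

text \<open>Reading \<open>u\<close> from \<open>v\<close> traces a closed walk of length at most
  \<open>r\<close>. By the condition on prefixes it meets \<open>v\<close> only at its two ends, so
  its interior is a walk in the punctured ball from the first neighbour of \<open>v\<close> on it to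
  the last.\<close>

lemma conn_of_closed_word:
  assumes u: "set u \<subseteq> S" "wprod u = \<one>" "2 \<le> length u" "length u \<le> r"
    and prefix: "\<And>k. 0 < k \<Longrightarrow> k < length u \<Longrightarrow> wprod (take k u) \<noteq> \<one>"
  shows "conn (hd u) (inv (last u))"
proof -
  have uc: "set u \<subseteq> carrier G" using u S_carrier by auto
  define f where "f k = v \<otimes> wprod (take k u)" for k
  have pc: "wprod (take k u) \<in> carrier G" for k
    using uc by (meson wprod_closed set_take_subset order_trans)
  have fc: "f k \<in> carrier G" for k using pc v_in by (simp add: f_def)
  have fs: "f (Suc k) = f k \<otimes> u ! k" if "k < length u" for k
  proof -
    have "u ! k \<in> carrier G" using uc that by auto
    moreover have "set (take k u) \<subseteq> carrier G" using uc by (meson set_take_subset order_trans)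
    ultimately show ?thesis using that pc v_in
      by (simp add: f_def take_Suc_conv_app_nth wprod_append m_assoc)
  qed
  define xs where "xs = map f [0..<Suc (length u)]"
  have nth: "xs ! k = f k" if "k \<le> length u" for k
    using that unfolding xs_def by (subst nth_map) (auto simp del: upt_Suc)
  have len: "length xs = Suc (length u)" by (simp add: xs_def)
  have f0: "f 0 = v" "f (length u) = v" using u v_in by (auto simp: f_def)
  have "walk (carrier G) (cayley_adj G S) xs"
    unfolding walk_def
  proof (intro conjI allI impI)
    show "xs \<noteq> []" using len by auto
    show "set xs \<subseteq> carrier G" using fc by (auto simp: xs_def)
    fix i assume "Suc i < length xs"
    then have i: "i < length u" using len by auto
    then have "xs ! Suc i = xs ! i \<otimes> u ! i" "u ! i \<in> S" using nth fs u(1) by auto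
    then show "cayley_adj G S (xs ! i) (xs ! Suc i)"
      using nth[of i] nth[of "Suc i"] i fc[of i] fc[of "Suc i"] by (auto simp: cayley_adj_def)
  qed
  moreover have "hd xs = v" "last xs = v"
    using f0 nth len by (auto simp: hd_conv_nth last_conv_nth simp flip: length_greater_0_conv)
  moreover have "v \<in> set xs" using f0 by (auto simp: xs_def)
  ultimately have cw: "closed_walk_through (carrier G) (cayley_adj G S) r v xs"
    using len u(4) by (simp add: closed_walk_through_def)
  have ne: "f k \<noteq> v" if "0 < k" "k < length u" for k
    using prefix[OF that] pc v_in by (simp add: f_def)
  have "step\<^sup>*\<^sup>* (f 1) (f k)" if "0 < k" "k < length u" for k
    using that
  proof (induction k)
    case (Suc k)
    show ?case
    proof (cases "k = 0")
      case False
      have "ball_edge (carrier G) (cayley_adj G S) r v (f k) (f (Suc k))"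
        unfolding ball_edge_def using cw Suc.prems len nth
        by (intro exI[of _ xs] conjI exI[of _ k]) auto
      then have "step (f k) (f (Suc k))" using ne Suc.prems False by (simp add: step_def)
      then show ?thesis using Suc False by (simp add: rtranclp.rtrancl_into_rtrancl)
    qed auto
  qed auto
  then have *: "step\<^sup>*\<^sup>* (f 1) (f (length u - 1))" using u by auto
  have "u \<noteq> []" using u by auto
  then have hl: "hd u \<in> carrier G" "last u \<in> carrier G" using uc by auto
  have "f 1 = v \<otimes> hd u" using fs[of 0] u f0 \<open>u \<noteq> []\<close> by (simp add: hd_conv_nth)
  moreover have "f (length u - 1) = v \<otimes> inv (last u)"
    using fs[of "length u - 1"] u f0 \<open>u \<noteq> []\<close> hl fc[of "length u - 1"] v_in
    by (simp add: last_conv_nth inv_solve_right)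
  ultimately show ?thesis using * by (simp add: conn_def)
qed

text \<open>The index modulo the length includes the corner from the last letter back to the
  first.\<close>

definition smooth :: "'a list \<Rightarrow> bool" where
  "smooth u \<longleftrightarrow> (\<forall>i<length u. conn (inv (u ! i)) (u ! (Suc i mod length u)))"

text \<open>Every rotation of \<open>u\<close> is again trivial, and minimality of \<open>u\<close>
  forbids trivial proper prefixes of the rotation, so \<open>conn_of_closed_word\<close> applies at
  each corner.\<close>

lemma smooth_if_minimal:
  assumes u: "set u \<subseteq> S" "wprod u = \<one>" "2 \<le> length u" "length u \<le> r"
    and minimal: "\<And>a b c. u = a @ b @ c \<Longrightarrow> b \<noteq> [] \<Longrightarrow> wprod b = \<one> \<Longrightarrow> length b = length u"
  shows "smooth u"
  unfolding smooth_def
proof (intro allI impI)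
  fix i assume i: "i < length u"
  \<comment> \<open>Cutting just after letter \<open>i\<close> makes \<open>q @ p\<close> end with
    \<open>u ! i\<close> and begin with its cyclic successor.\<close>
  define p q where "p = take (Suc i) u" and "q = drop (Suc i) u"
  have pq: "u = p @ q" by (simp add: p_def q_def)
  have pne: "p \<noteq> []" using i by (auto simp: p_def)
  have uc: "set p \<subseteq> carrier G" "set q \<subseteq> carrier G" using u S_carrier pq by auto
  have one: "wprod (q @ p) = \<one>" using wprod_rotate_eq_one[OF uc] u(2) pq by simp
  have "conn (hd (q @ p)) (inv (last (q @ p)))"
  proof (rule conn_of_closed_word)
    show "set (q @ p) \<subseteq> S" "2 \<le> length (q @ p)" "length (q @ p) \<le> r" using u pq by auto
    show "wprod (q @ p) = \<one>" by (rule one)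
    fix k assume k: "0 < k" "k < length (q @ p)"
    show "wprod (take k (q @ p)) \<noteq> \<one>"
    proof (cases "k \<le> length q")
      case True
      show ?thesis
      proof
        assume "wprod (take k (q @ p)) = \<one>"
        then have "length (take k q) = length u"
          using minimal[of p "take k q" "drop k q"] pq k True by fastforce
        then show False using True k pq by auto
      qed
    next
      case False
      \<comment> \<open>The prefix \<open>q @ p'\<close> wraps around the end of \<open>u\<close>
        and need not be a subword of it. Its complement \<open>p''\<close> is one, and it is trivial
        as soon as the prefix is.\<close>
      define p' p'' where "p' = take (k - length q) p" and "p'' = drop (k - length q) p"
      have pp: "p = p' @ p''" by (simp add: p'_def p''_def)
      have ne: "p'' \<noteq> []" "p' \<noteq> []" using k False by (auto simp: p'_def p''_def)
      show ?thesis
      proof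
        assume "wprod (take k (q @ p)) = \<one>"
        then have "wprod (q @ p') = \<one>" using False by (simp add: p'_def)
        moreover have "wprod ((q @ p') @ p'') = wprod (q @ p') \<otimes> wprod p''"
          using uc pp by (intro wprod_append) auto
        moreover have "set p'' \<subseteq> carrier G" using uc pp by auto
        ultimately have "wprod p'' = \<one>" using one pp by (simp add: wprod_closed)
        then have "length p'' = length u" using minimal[of p' p'' q] pq pp ne by auto
        then show False using pq pp ne by auto
      qed
    qed
  qed
  moreover have "last (q @ p) = u ! i" using pne i by (simp add: p_def last_conv_nth)
  moreover have "hd (q @ p) = u ! (Suc i mod length u)"
  proof (cases "Suc i = length u")
    case True
    then show ?thesis using pne u by (simp add: p_def q_def hd_conv_nth)
  next
    case False
    then show ?thesis using i by (simp add: q_def hd_append hd_drop_conv_nth)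
  qed
  ultimately show "conn (inv (u ! i)) (u ! (Suc i mod length u))" using conn_sym by simp
qed

text \<open>Descent on length: either a shorter nonempty trivial subword exists, or \<open>w\<close>
  is itself minimal. Single letters are excluded because the neutral element is not a
  generator.\<close>

lemma smooth_subword:
  assumes "set w \<subseteq> S" "w \<noteq> []" "wprod w = \<one>" "length w \<le> r"
  shows "\<exists>a u b. w = a @ u @ b \<and> 2 \<le> length u \<and> wprod u = \<one> \<and> smooth u"
  using assms
proof (induction "length w" arbitrary: w rule: less_induct)
  case less
  have len: "2 \<le> length w"
  proof (rule ccontr)
    assume "\<not> 2 \<le> length w"
    then obtain x where "w = [x]" using less.prems(2) by (cases w; cases "tl w") auto
    then show False using less.prems one_notin_S S_carrier by auto
  qed
  show ?case
  proof (cases "\<exists>a b c. w = a @ b @ c \<and> b \<noteq> [] \<and> wprod b = \<one> \<and> length b < length w")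
    case True
    then obtain a b c where abc: "w = a @ b @ c" "b \<noteq> []" "wprod b = \<one>" "length b < length w"
      by blast
    then obtain a' u b' where "b = a' @ u @ b'" "2 \<le> length u" "wprod u = \<one>" "smooth u"
      using less.hyps[of b] less.prems by auto
    then show ?thesis using abc by (intro exI[of _ "a @ a'"] exI[of _ u] exI[of _ "b' @ c"]) auto
  next
    case False
    have "smooth w"
    proof (rule smooth_if_minimal)
      fix a b c assume "w = a @ b @ c" "b \<noteq> []" "wprod b = \<one>"
      then show "length b = length w" using False by (metis length_append
          linorder_neqE_nat not_add_less1 add.assoc add.commute)
    qed (use less.prems len in auto)
    then show ?thesis using less.prems len by (intro exI[of _ "[]"] exI[of _ w]) auto
  qed
qed

text \<open>A closed walk through \<open>v\<close> and \<open>a\<close> is followed from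
  \<open>v\<close> to \<open>a\<close>. What matters is the stretch after the last visit to
  \<open>v\<close>, which starts at a neighbour of \<open>v\<close>.\<close>

lemma ball_vert_connected_to_neighbour:
  assumes "a \<in> ball_verts (carrier G) (cayley_adj G S) r v" "a \<noteq> v"
  shows "\<exists>s\<in>S. step\<^sup>*\<^sup>* (v \<otimes> s) a"
proof -
  obtain xs where cw: "closed_walk_through (carrier G) (cayley_adj G S) r v xs" and "a \<in> set xs"
    using assms(1) by (auto simp: ball_verts_def)
  then obtain i j where i: "i < length xs" "xs ! i = v" and j: "j < length xs" "xs ! j = a"
    by (metis closed_walk_through_def in_set_conv_nth)
  \<comment> \<open>\<open>Q\<close> is vacuous at positions where the walk is at \<open>v\<close>,
    so the induction simply restarts there with a new generator.\<close>
  define Q where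
    "Q k \<longleftrightarrow> (k < length xs \<longrightarrow> xs ! k \<noteq> v \<longrightarrow> (\<exists>s\<in>S. step\<^sup>*\<^sup>* (v \<otimes> s) (xs ! k)))" for k
  have adj: "cayley_adj G S (xs ! k) (xs ! Suc k)" if "Suc k < length xs" for k
    using that cw by (auto simp: closed_walk_through_def walk_def)
  have adj_sym: "cayley_adj G S x y \<Longrightarrow> cayley_adj G S y x" for x y
    by (auto simp: cayley_adj_def)
  have adj_v: "\<exists>s\<in>S. y = v \<otimes> s" if "cayley_adj G S v y" for y
  proof -
    have "\<exists>s\<in>S. y = v \<otimes> s" if "s \<in> S" "v = y \<otimes> s" "y \<in> carrier G" for s
      using that S_inv[of s] S_carrier by (intro bexI[of _ "inv s"]) (auto simp: m_assoc)
    then show ?thesis using that by (auto simp: cayley_adj_def)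
  qed
  \<comment> \<open>Both directions are needed, since \<open>a\<close> may occur before or after the
    chosen occurrence of \<open>v\<close> in the list.\<close>
  have move: "Q l" if Qk: "Q k" "k < length xs" and kl: "l = Suc k \<or> k = Suc l" for k l
    unfolding Q_def
  proof (intro impI)
    assume l: "l < length xs" "xs ! l \<noteq> v"
    have e: "cayley_adj G S (xs ! k) (xs ! l)" using Qk kl l adj adj_sym by auto
    have b: "ball_edge (carrier G) (cayley_adj G S) r v (xs ! k) (xs ! l)"
      unfolding ball_edge_def using cw Qk kl l by blast
    show "\<exists>s\<in>S. step\<^sup>*\<^sup>* (v \<otimes> s) (xs ! l)"
    proof (cases "xs ! k = v")
      case True
      then show ?thesis using adj_v e by fastforce
    next
      case False
      then obtain s where "s \<in> S" "step\<^sup>*\<^sup>* (v \<otimes> s) (xs ! k)"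
        using Qk by (auto simp: Q_def)
      moreover have "step (xs ! k) (xs ! l)" using b l False by (simp add: step_def)
      ultimately show ?thesis by (meson rtranclp.rtrancl_into_rtrancl)
    qed
  qed
  have Qi: "Q i" using i by (simp add: Q_def)
  have "Q j"
  proof (cases "i \<le> j")
    case True
    then show ?thesis
    proof (induction rule: dec_induct)
      case (step k)
      then show ?case using move[of k "Suc k"] j by auto
    qed (rule Qi)
  next
    case False
    then have "j \<le> i" by simp
    then show ?thesis
    proof (induction rule: inc_induct)
      case (step k)
      then show ?case using move[of "Suc k" k] i by auto
    qed (rule Qi)
  qed
  then show ?thesis using j assms(2) by (auto simp: Q_def)
qed

lemma cutvertex_disconnects_generators:
  assumes "local_cutvertex (carrier G) (cayley_adj G S) r v"
  obtains s t where "s \<in> S" "t \<in> S" "\<not> conn s t"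
proof -
  obtain a b where "a \<in> ball_verts (carrier G) (cayley_adj G S) r v" "a \<noteq> v"
    "b \<in> ball_verts (carrier G) (cayley_adj G S) r v" "b \<noteq> v" "\<not> step\<^sup>*\<^sup>* a b"
    using assms by (auto simp: local_cutvertex_def step_def[abs_def])
  then obtain s t where st: "s \<in> S" "t \<in> S" "step\<^sup>*\<^sup>* (v \<otimes> s) a" "step\<^sup>*\<^sup>* (v \<otimes> t) b"
    using ball_vert_connected_to_neighbour by meson
  then have "\<not> step\<^sup>*\<^sup>* (v \<otimes> s) (v \<otimes> t)"
    using \<open>\<not> step\<^sup>*\<^sup>* a b\<close> step_sym by (meson rtranclp_trans)
  then show ?thesis using that st by (auto simp: conn_def)
qed

end

section \<open>Combinatorics of the reduced commutator words\<close>

fun flip :: "bool \<times> bool \<Rightarrow> bool \<times> bool" where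
  "flip (l, s) = (l, \<not> s)"

text \<open>A pair (letter, sign) encodes \<open>g\<close>, \<open>h\<close> (letters \<open>True\<close>, \<open>False\<close>) or their inverses
  (sign \<open>False\<close>). \<open>comm_word k\<close> is the reduced word of the iterated commutator of index \<open>k + 1\<close>, not
  \<open>k\<close>; its leading \<open>g\<close> cancels against the inverse of \<open>g\<close> preceding it, hence the \<open>tl\<close>.\<close>
fun comm_word :: "nat \<Rightarrow> (bool \<times> bool) list" where
  "comm_word 0 = [(True, True), (False, False), (True, False), (False, True)]"
| "comm_word (Suc k) = (True, True) # rev (map flip (comm_word k)) @ tl (comm_word k)"

text \<open>The two initial and three final letters do not depend on \<open>k\<close>. They
  determine what happens wherever the recursion glues words together.\<close>

lemma comm_word_prefix: "\<exists>m. comm_word k = (True, True) # (False, False) # m"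
  and comm_word_suffix: "\<exists>m. comm_word k = (True, True) # m @ [(False, False), (True, False), (False, True)]"
proof -
  have "(\<exists>m. comm_word k = (True, True) # (False, False) # m) \<and>
    (\<exists>m. comm_word k = (True, True) # m @ [(False, False), (True, False), (False, True)])"
  proof (induction k)
    case (Suc k)
    then obtain m where "comm_word k = (True, True) # m @ [(False, False), (True, False), (False, True)]"
      by blast
    then show ?case by simp
  qed simp
  then show "\<exists>m. comm_word k = (True, True) # (False, False) # m"
    "\<exists>m. comm_word k = (True, True) # m @ [(False, False), (True, False), (False, True)]"
    by blast+
qed

lemma length_comm_word: "length (comm_word k) = 2 ^ (k + 2)"
proof (induction k)
  case (Suc k)
  then have "0 < length (comm_word k)" by simp
  then show ?case using Suc by simp
qed simp

definition letters_alternate :: "(bool \<times> bool) list \<Rightarrow> bool" where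
  "letters_alternate w \<longleftrightarrow> successively (\<lambda>x y. fst x \<noteq> fst y) w"

lemma fst_flip: "fst (flip x) = fst x" and snd_flip: "snd (flip x) = (\<not> snd x)"
  by (cases x; simp)+

lemma letters_alternate_comm_word: "letters_alternate (comm_word k)"
proof (induction k)
  case 0
  then show ?case by (simp add: letters_alternate_def)
next
  case (Suc k)
  obtain m where m: "comm_word k = (True, True) # (False, False) # m"
    using comm_word_prefix by blast
  obtain m' where m': "comm_word k = (True, True) # m' @ [(False, False), (True, False), (False, True)]"
    using comm_word_suffix by blast
  have "successively (\<lambda>x y. fst x \<noteq> fst y) (rev (map flip (comm_word k)))"
    using Suc unfolding letters_alternate_def successively_rev successively_map fst_flip
    by (simp add: eq_commute)
  moreover have "successively (\<lambda>x y. fst x \<noteq> fst y) (tl (comm_word k))"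
    using Suc by (simp add: letters_alternate_def m)
  moreover have "hd (rev (map flip (comm_word k))) = (False, False)" by (simp add: m')
  moreover have "last (rev (map flip (comm_word k))) = (True, False)"
     by (simp add: m)
  moreover have "hd (tl (comm_word k)) = (False, False)" by (simp add: m)
  moreover have "rev (map flip (comm_word k)) \<noteq> []" by (simp add: m)
  ultimately show ?case
    by (simp add: letters_alternate_def successively_append_iff successively_Cons)
qed

definition no_alternating_signs4 :: "(bool \<times> bool) list \<Rightarrow> bool" where
  "no_alternating_signs4 w \<longleftrightarrow> (\<forall>i. i + 3 < length w \<longrightarrow>
     snd (w ! i) = snd (w ! (i + 1)) \<or> snd (w ! (i + 1)) = snd (w ! (i + 2)) \<or>
     snd (w ! (i + 2)) = snd (w ! (i + 3)))"

lemma no_alternating_signs4_subword: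
  assumes "no_alternating_signs4 (a @ u @ b)" shows "no_alternating_signs4 u"
  unfolding no_alternating_signs4_def
proof (intro allI impI)
  fix i assume "i + 3 < length u"
  then show "snd (u ! i) = snd (u ! (i + 1)) \<or> snd (u ! (i + 1)) = snd (u ! (i + 2)) \<or>
     snd (u ! (i + 2)) = snd (u ! (i + 3))"
    using assms[unfolded no_alternating_signs4_def, rule_format, of "length a + i"]
    by (simp add: nth_append)
qed

text \<open>Flipping all signs preserves agreement of neighbours, and reversal sends the window at
  \<open>i\<close> to the window starting at \<open>j\<close>.\<close>

lemma no_alternating_signs4_rev_flip:
  assumes "no_alternating_signs4 w" shows "no_alternating_signs4 (rev (map flip w))"
  unfolding no_alternating_signs4_def
proof (intro allI impI)
  fix i assume i: "i + 3 < length (rev (map flip w))"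
  define j where "j = length w - (i + 4)"
  have "length w - Suc i = j + 3" "length w - Suc (i + 1) = j + 2"
    "length w - Suc (i + 2) = j + 1" "length w - Suc (i + 3) = j" "j + 3 < length w"
    using i by (auto simp: j_def)
  then show "snd (rev (map flip w) ! i) = snd (rev (map flip w) ! (i + 1)) \<or>
      snd (rev (map flip w) ! (i + 1)) = snd (rev (map flip w) ! (i + 2)) \<or>
      snd (rev (map flip w) ! (i + 2)) = snd (rev (map flip w) ! (i + 3))"
    using i assms[unfolded no_alternating_signs4_def, rule_format, of j]
    by (simp add: rev_nth snd_flip del: add_2_eq_Suc' One_nat_def) auto
qed

text \<open>A window of four that straddles the junction contains the agreeing pair there; any other
  window lies in one of the two words.\<close>

lemma no_alternating_signs4_append:
  assumes "no_alternating_signs4 a" "no_alternating_signs4 b" "a \<noteq> []" "b \<noteq> []" "snd (last a) = snd (hd b)"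
  shows "no_alternating_signs4 (a @ b)"
  unfolding no_alternating_signs4_def
proof (intro allI impI)
  fix i assume i: "i + 3 < length (a @ b)"
  have j: "snd ((a @ b) ! (length a - 1)) = snd ((a @ b) ! length a)"
    using assms(3-5) by (simp add: nth_append last_conv_nth hd_conv_nth)
  consider "i + 3 < length a" | "length a \<le> i" | "i = length a - 1" | "i + 1 = length a - 1"
    | "i + 2 = length a - 1" by linarith
  then show "snd ((a @ b) ! i) = snd ((a @ b) ! (i + 1)) \<or> snd ((a @ b) ! (i + 1)) = snd ((a @ b) ! (i + 2)) \<or>
     snd ((a @ b) ! (i + 2)) = snd ((a @ b) ! (i + 3))"
  proof cases
    case 1
    then show ?thesis using assms(1)[unfolded no_alternating_signs4_def, rule_format, of i]
      by (simp add: nth_append)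
  next
    case 2
    then show ?thesis using i assms(2)[unfolded no_alternating_signs4_def, rule_format, of "i - length a"]
      by (simp add: nth_append Suc_diff_le)
  next
    case 3
    then have "length a = i + 1" using assms(3) by (cases a) auto
    then show ?thesis using j by simp
  next
    case 4
    then have "length a = i + 2" by simp
    then show ?thesis using j by simp
  next
    case 5
    then have "length a = i + 3" by simp
    then show ?thesis using j by simp
  qed
qed

lemma no_alternating_signs4_comm_word: "no_alternating_signs4 (comm_word k)"
proof (induction k)
  case 0
  then show ?case by (simp add: no_alternating_signs4_def)
next
  case (Suc k)
  obtain m where m: "comm_word k = (True, True) # (False, False) # m"
    using comm_word_prefix by blast
  obtain m' where m': "comm_word k = (True, True) # m' @ [(False, False), (True, False), (False, True)]"
    using comm_word_suffix by blast
  \<comment> \<open>Signs disagree right after the new leading letter, so the cut is made two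
    letters later: the third and fourth letters are \<open>(True, True)\<close> and
    \<open>(False, True)\<close>, with equal signs.\<close>
  have "no_alternating_signs4 ([(True, True), (False, False), (True, True)] @ (tl (tl (rev (map flip (comm_word k))))))"
  proof (rule no_alternating_signs4_append)
    show "no_alternating_signs4 (tl (tl (rev (map flip (comm_word k)))))"
      using no_alternating_signs4_rev_flip[OF Suc] no_alternating_signs4_subword[of "[(False,False),(True,True)]" _ "[]"]
      by (simp add: m')
  qed (auto simp: m' no_alternating_signs4_def)
  then have "no_alternating_signs4 ((True, True) # rev (map flip (comm_word k)))" by (simp add: m')
  moreover have "no_alternating_signs4 (tl (comm_word k))"
    using Suc no_alternating_signs4_subword[of "[(True, True)]" "tl (comm_word k)" "[]"] by (simp add: m)
  ultimately show ?case
    using no_alternating_signs4_append[of "(True, True) # rev (map flip (comm_word k))" "tl (comm_word k)"]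
    by (simp add: m)
qed

section \<open>Evaluation of commutator words in the group\<close>

context group
begin

fun spell :: "'a \<Rightarrow> 'a \<Rightarrow> bool \<times> bool \<Rightarrow> 'a" where
  "spell g h (l, s) = (let x = if l then g else h in if s then x else inv x)"

lemma spell_closed: "g \<in> carrier G \<Longrightarrow> h \<in> carrier G \<Longrightarrow> spell g h x \<in> carrier G"
  by (cases x) (auto simp: Let_def)

lemma inv_spell: "g \<in> carrier G \<Longrightarrow> h \<in> carrier G \<Longrightarrow> inv (spell g h x) = spell g h (flip x)"
  by (cases x) (auto simp: Let_def)

lemma wprod_comm_word:
  assumes g: "g \<in> carrier G" and h: "h \<in> carrier G"
  shows "wprod (map (spell g h) (comm_word k)) = iter_comm G (Suc k) g h"
proof (induction k)
  case 0
  then show ?case using assms by (simp add: m_assoc)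
next
  case (Suc k)
  define w where "w = map (spell g h) (comm_word k)"
  obtain m where m: "comm_word k = (True, True) # m"
    using comm_word_prefix by blast
  have w: "w = g # tl w" by (simp add: w_def m)
  have wc: "set w \<subseteq> carrier G" using assms by (auto simp: w_def spell_closed)
  then have tc: "set (tl w) \<subseteq> carrier G" by (metis list.set_sel(2) subset_code(1) tl_Nil)
  have ic: "set (rev (map (m_inv G) w)) \<subseteq> carrier G" using wc by auto
  have "map (spell g h) (comm_word (Suc k)) = g # rev (map (m_inv G) w) @ tl w"
    using assms by (simp add: w_def rev_map map_tl inv_spell)
  then have "wprod (map (spell g h) (comm_word (Suc k))) = g \<otimes> (inv (wprod w) \<otimes> wprod (tl w))"
    using wprod_append[OF ic tc] wc by (simp add: wprod_rev_inv)
  \<comment> \<open>Dropping the leading \<open>g\<close> multiplies by \<open>inv g\<close> on the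
    left, which supplies the factor \<open>inv g\<close> in the recursion of
    \<open>iter_comm\<close>.\<close>
  moreover have "wprod w = g \<otimes> wprod (tl w)" by (subst w) simp
  then have "wprod (tl w) = inv g \<otimes> wprod w"
    using g wc tc by (simp add: wprod_closed m_assoc[symmetric])
  ultimately have "wprod (map (spell g h) (comm_word (Suc k))) =
      g \<otimes> inv (wprod w) \<otimes> inv g \<otimes> wprod w"
    using g wc by (simp add: wprod_closed m_assoc)
  then show ?case using Suc by (simp add: w_def)
qed

end

section \<open>Connecting generators that are not mutually equivalent\<close>

context cayley_ball
begin

lemma spell_in_S: "g \<in> S \<Longrightarrow> h \<in> S \<Longrightarrow> spell g h x \<in> S"
  by (cases x) (auto simp: Let_def S_inv)

text \<open>The commutator word has length \<open>2 ^ (k + 2)\<close>, hence at most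
  \<open>r\<close>. Its smooth subword is contiguous and so inherits both combinatorial
  properties.\<close>

lemma smooth_spelling:
  assumes gh: "g \<in> S" "h \<in> S"
    and trivial: "iter_comm G (Suc k) g h = \<one>" and r: "2 ^ (k + 2) \<le> r"
  obtains u where "2 \<le> length u" "letters_alternate u" "no_alternating_signs4 u"
    "wprod (map (spell g h) u) = \<one>" "smooth (map (spell g h) u)"
proof -
  have c: "g \<in> carrier G" "h \<in> carrier G" using gh S_carrier by auto
  have ne: "comm_word k \<noteq> []" using comm_word_prefix[of k] by auto
  have "\<exists>a u b. map (spell g h) (comm_word k) = a @ u @ b \<and> 2 \<le> length u \<and> wprod u = \<one> \<and> smooth u"
    using r wprod_comm_word[OF c, of k] trivial ne
    by (intro smooth_subword) (auto simp: spell_in_S gh length_comm_word simp del: spell.simps iter_comm.simps)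
  then obtain a u b where u: "map (spell g h) (comm_word k) = a @ u @ b"
      "2 \<le> length u" "wprod u = \<one>" "smooth u" by blast
  then obtain a' u' b' where u': "comm_word k = a' @ u' @ b'" "u = map (spell g h) u'"
    by (smt (verit) map_eq_append_conv)
  have "letters_alternate u'" using letters_alternate_comm_word[of k] u'(1)
    by (auto simp: letters_alternate_def successively_append_iff)
  moreover have "no_alternating_signs4 u'" using no_alternating_signs4_comm_word[of k] u'(1) no_alternating_signs4_subword by metis
  ultimately show ?thesis using that[of u'] u u' by auto
qed

lemma smooth_spellD:
  assumes "g \<in> S" "h \<in> S" "smooth (map (spell g h) u)" "i < length u"
  shows "conn (spell g h (flip (u ! i))) (spell g h (u ! (Suc i mod length u)))"
proof -
  have "Suc i mod length u < length u" using assms(4) by (intro mod_less_divisor) auto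
  then show ?thesis using assms S_carrier inv_spell[of g h "u ! i"]
    by (auto simp: smooth_def subset_iff)
qed

text \<open>The first corner of the smooth subword joins some power \<open>g\<close> or
  \<open>inv g\<close> to some power \<open>h\<close> or \<open>inv h\<close>, because letters
  alternate.\<close>

lemma some_spelling_connected:
  assumes gh: "g \<in> S" "h \<in> S"
    and trivial: "iter_comm G (Suc k) g h = \<one>" and r: "2 ^ (k + 2) \<le> r"
  shows "\<exists>s t. conn (spell g h (True, s)) (spell g h (False, t))"
proof -
  obtain u where u: "2 \<le> length u" "letters_alternate u" "smooth (map (spell g h) u)"
    using smooth_spelling[OF assms] by metis
  then obtain x y u' where xy: "u = x # y # u'" by (cases u; cases "tl u") auto
  have "conn (spell g h (flip x)) (spell g h y)"
    using smooth_spellD[OF gh u(3), of 0] xy by simp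
  moreover have "fst x \<noteq> fst y" using u(2) xy by (simp add: letters_alternate_def)
  ultimately show ?thesis
    by (cases x; cases y; cases "fst x") (auto simp del: spell.simps dest: conn_sym)
qed

text \<open>One connection between \<open>g\<close> and \<open>h\<close> spreads to their inverses
  by following the corners of a smooth subword, with cases by its length.\<close>

lemma all_spellings_connected:
  assumes gh: "g \<in> S" "h \<in> S" "\<not> equiv_inv G g h"
    and trivial: "iter_comm G (Suc k) g h = \<one>" and r: "2 ^ (k + 2) \<le> r"
    and "conn g h"
  shows "conn (spell g h x) (spell g h y)"
proof -
  have c: "g \<in> carrier G" "h \<in> carrier G" using gh S_carrier by auto
  \<comment> \<open>Replacing connectedness by equality of classes turns the corner conditions into
    equations that can be chained automatically.\<close>
  define C where "C x = {y. conn (spell g h x) y}" for x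
  have C: "conn (spell g h x) (spell g h y) \<longleftrightarrow> C x = C y" for x y
    unfolding C_def using conn_refl conn_sym conn_trans by blast
  have base: "C (True, True) = C (False, True)" using C[of "(True,True)" "(False,True)"] \<open>conn g h\<close> by simp
  obtain u where u: "2 \<le> length u" "letters_alternate u" "no_alternating_signs4 u"
    "wprod (map (spell g h) u) = \<one>" "smooth (map (spell g h) u)"
    using smooth_spelling[OF gh(1,2) trivial r] by metis
  have sm: "C (flip (u ! i)) = C (u ! (Suc i mod length u))" if "i < length u" for i
    using smooth_spellD[OF gh(1,2) u(5) that] C by simp
  have "C (True, True) = C (True, False) \<and> C (True, True) = C (False, False)"
  proof -
    consider p q where "u = [p, q]" | p q t where "u = [p, q, t]" | p q t z l where "u = p # q # t # z # l"
      using u(1) by (metis One_nat_def Suc_1 Suc_le_length_iff neq_Nil_conv)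
    then show ?thesis
    proof cases
      \<comment> \<open>A trivial word of two alternating letters would give
        \<open>equiv_inv G g h\<close>.\<close>
      case 1
      obtain l s l' s' where p: "p = (l, s)" "q = (l', s')" by (cases p; cases q) auto
      have "l' = (\<not> l)" using u(2) p 1 by (auto simp: letters_alternate_def)
      moreover have "spell g h p \<otimes> spell g h q = \<one>" using u(4) 1 c by (simp add: spell_closed)
      then have "spell g h p = inv (spell g h q)" using c by (simp add: spell_closed inv_equality[symmetric])
      then have "spell g h p = spell g h (flip q)" using c by (simp add: inv_spell)
      ultimately have False using gh(3) c p
        by (auto simp: equiv_inv_def Let_def split: if_splits dest: inj_onD[OF inv_inj])
      then show ?thesis ..
    next
      case 2
      obtain l s l' s' l'' s'' where p: "p = (l, s)" "q = (l', s')" "t = (l'', s'')"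
        by (cases p; cases q; cases t) auto
      have l: "l' = (\<not> l)" "l'' = l" using u(2) p 2 by (auto simp: letters_alternate_def)
      have pr: "spell g h p \<otimes> (spell g h q \<otimes> spell g h t) = \<one>" using u(4) 2 c by (simp add: spell_closed)
      \<comment> \<open>Otherwise the outer letters are mutually inverse, and the middle one is a
        conjugate of the neutral element.\<close>
      have "s'' = s"
      proof (rule ccontr)
        assume "s'' \<noteq> s"
        then have t: "spell g h t = inv (spell g h p)" using p l c by (simp add: inv_spell)
        have "spell g h q = \<one>"
          using pr unfolding t using spell_closed[OF c, of p] spell_closed[OF c, of q]
          by (metis inv_closed inv_equality inv_inv l_cancel_one m_assoc m_closed r_cancel_one')
        then show False using spell_in_S[OF gh(1,2), of q] one_notin_S by simp
      qed
      \<comment> \<open>The closing corner joins the outer letter to its own inverse; the other two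
        corners bring in the middle letter.\<close>
      then show ?thesis using sm[of 0] sm[of 1] sm[of 2] 2 p l base
        by (cases l; cases s; cases s') auto
    next
      case 3
      obtain l1 s1 l2 s2 l3 s3 l4 s4 where p: "p = (l1, s1)" "q = (l2, s2)" "t = (l3, s3)" "z = (l4, s4)"
        by (cases p; cases q; cases t; cases z) auto
      have l: "l2 = (\<not> l1)" "l3 = l1" "l4 = (\<not> l1)" using u(2) p 3 by (auto simp: letters_alternate_def)
      have "s1 = s2 \<or> s2 = s3 \<or> s3 = s4"
        using u(3)[unfolded no_alternating_signs4_def, rule_format, of 0] 3 p by (simp add: eval_nat_numeral)
      \<comment> \<open>A corner with equal signs joins one of \<open>g\<close>, \<open>h\<close> to
        the inverse of the other; a corner from positive to negative sign joins the two inverses.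
        With \<open>base\<close>, three corners that do not strictly alternate in sign
        suffice.\<close>
      then show ?thesis using sm[of 0] sm[of 1] sm[of 2] 3 p l base
        by (cases l1; cases s1; cases s2; cases s3; cases s4) auto
    qed
  qed
  then have "C (l, s) = C (True, True)" for l s using base by (cases l; cases s) auto
  then have "C x = C y" by (cases x; cases y) metis
  then show ?thesis using C by simp
qed

text \<open>Some signed versions \<open>g'\<close> and \<open>h'\<close> of the two generators are
  connected. They again lie in \<open>S\<close> and are not equivalent, so all their spellings are
  connected.\<close>

lemma conn_if_not_equiv_inv:
  assumes gh: "g \<in> S" "h \<in> S" "\<not> equiv_inv G g h"
    and nil: "nilpotent_class_le G (Suc k)" and r: "2 ^ (k + 2) \<le> r"
  shows "conn g h"
proof -
  have c: "g \<in> carrier G" "h \<in> carrier G" using gh S_carrier by auto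
  have trivial: "iter_comm G (Suc k) x y = \<one>"
    if "x \<in> S" "y \<in> S" "\<not> equiv_inv G x y" for x y
    using nil that S_carrier by (auto simp: nilpotent_class_le_def)
  obtain s t where st: "conn (spell g h (True, s)) (spell g h (False, t))"
    using some_spelling_connected[OF gh(1,2) trivial[OF gh] r] by blast
  define g' h' where "g' = spell g h (True, s)" and "h' = spell g h (False, t)"
  have in_S: "g' \<in> S" "h' \<in> S" using gh by (auto simp: g'_def h'_def spell_in_S simp del: spell.simps)
  have ne: "\<not> equiv_inv G g' h'"
    using gh(3) c by (auto simp: g'_def h'_def equiv_inv_def split: if_splits)
  \<comment> \<open>Applying the same signs a second time undoes them, so these spellings are
    \<open>g\<close> and \<open>h\<close>.\<close>
  have "conn (spell g' h' (True, s)) (spell g' h' (False, t))"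
    using all_spellings_connected[OF in_S ne trivial[OF in_S ne] r] st
    by (simp add: g'_def h'_def del: spell.simps)
  then show ?thesis using c by (cases s; cases t) (auto simp: g'_def h'_def)
qed

end

section \<open>The remaining case of a single generator and its inverse\<close>

lemma (in group) power_cycle_graph:
  assumes s: "s \<in> carrier G" and gen: "generate G {s} = carrier G" and "3 \<le> ord s"
  shows "is_cycle_graph (carrier G) (cayley_adj G {s, inv s}) (ord s)"
proof -
  define f where "f i = s [^] i" for i :: nat
  have fc: "f i \<in> carrier G" for i using s by (simp add: f_def)
  have interval: "{0..ord s - 1} = {..<ord s}" using assms(3) by auto
  have "carrier G = {s [^] i | i. i \<in> {0..ord s - 1}}"
    using generate_pow_nat[OF s] ord_elems_inf_carrier[OF s] gen assms(3) by auto
  then have car: "carrier G = f ` {..<ord s}"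
    unfolding interval by (auto simp: f_def)
  have bij: "bij_betw f {..<ord s} (carrier G)"
    unfolding bij_betw_def using car ord_inj[OF s] unfolding interval by (simp add: f_def[abs_def])
  have succ: "f (Suc i mod ord s) = f i \<otimes> s" if "i < ord s" for i
  proof (cases "Suc i = ord s")
    case True
    then have "f i \<otimes> s = \<one>" using s nat_pow_Suc[of s i] pow_ord_eq_1[OF s] by (simp add: f_def)
    then show ?thesis using True by (simp add: f_def)
  next
    case False
    then show ?thesis using that by (simp add: f_def)
  qed
  \<comment> \<open>An edge labelled \<open>inv s\<close> is an edge labelled \<open>s\<close> read
    backwards.\<close>
  have adj: "cayley_adj G {s, inv s} x y \<longleftrightarrow>
      x \<in> carrier G \<and> y \<in> carrier G \<and> (y = x \<otimes> s \<or> x = y \<otimes> s)" for x y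
    using s by (auto simp: cayley_adj_def m_assoc)
  have "cayley_adj G {s, inv s} x y \<longleftrightarrow>
    (\<exists>i<ord s. (x = f i \<and> y = f (Suc i mod ord s)) \<or> (y = f i \<and> x = f (Suc i mod ord s)))" for x y
  proof
    assume "cayley_adj G {s, inv s} x y"
    then have c: "x \<in> f ` {..<ord s}" "y \<in> f ` {..<ord s}" and "y = x \<otimes> s \<or> x = y \<otimes> s"
      unfolding adj car by auto
    then show "\<exists>i<ord s. (x = f i \<and> y = f (Suc i mod ord s)) \<or> (y = f i \<and> x = f (Suc i mod ord s))"
      using succ by fastforce
  next
    assume "\<exists>i<ord s. (x = f i \<and> y = f (Suc i mod ord s)) \<or> (y = f i \<and> x = f (Suc i mod ord s))"
    then show "cayley_adj G {s, inv s} x y"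
      unfolding adj using fc succ by metis
  qed
  then show ?thesis unfolding is_cycle_graph_def using assms(3) bij by blast
qed

lemma (in group) generate_insert_inv:
  assumes "s \<in> carrier G"
  shows "generate G {s, inv s} = generate G {s}"
proof
  have "{s, inv s} \<subseteq> generate G {s}" by (auto intro: generate.intros)
  then show "generate G {s, inv s} \<subseteq> generate G {s}"
    using generate_subgroup_incl generate_is_subgroup assms by simp
  show "generate G {s} \<subseteq> generate G {s, inv s}" by (rule mono_generate) simp
qed

lemma (in cayley_ball) cutvertex_imp_cycle:
  assumes "finite (carrier G)"
    and nil: "nilpotent_class_le G (Suc k)" and r: "2 ^ (k + 2) \<le> r"
    and v: "local_cutvertex (carrier G) (cayley_adj G S) r v"
  shows "(\<exists>m>r. is_cycle_graph (carrier G) (cayley_adj G S) m) \<and> cyclic_group G"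
proof -
  have eq: "conn x y" if "x \<in> S" "y \<in> S" "\<not> equiv_inv G x y" for x y
    using conn_if_not_equiv_inv[OF that nil r] .
  obtain s t where st: "s \<in> S" "t \<in> S" "\<not> conn s t"
    using cutvertex_disconnects_generators[OF v] by blast
  have sc: "s \<in> carrier G" using st S_carrier by auto
  have t: "t = inv s" "t \<noteq> s"
    using eq[OF st(2,1)] st conn_sym conn_refl by (auto simp: equiv_inv_def)
  \<comment> \<open>A third generator would be connected to both \<open>s\<close> and
    \<open>inv s\<close>, and hence would connect them.\<close>
  have S: "S = {s, inv s}"
  proof (rule ccontr)
    assume "S \<noteq> {s, inv s}"
    then obtain x where x: "x \<in> S" "x \<noteq> s" "x \<noteq> inv s" using st t by blast
    then have "\<not> equiv_inv G x s" "\<not> equiv_inv G x (inv s)"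
      using sc by (auto simp: equiv_inv_def)
    then show False using eq[of x s] eq[of x t] st t x conn_sym conn_trans by blast
  qed
  have gen: "generate G {s} = carrier G"
    using S_generates generate_insert_inv[OF sc] S by simp
  have "ord s \<noteq> 0" using ord_ge_1[OF assms(1) sc] by simp
  moreover have "ord s \<noteq> 1" using ord_eq_1[OF sc] one_notin_S st by auto
  moreover have "ord s \<noteq> 2"
  proof
    assume "ord s = 2"
    then have "s \<otimes> s = \<one>" using pow_ord_eq_1[OF sc] sc by (simp add: numeral_2_eq_2)
    then show False using t inv_equality sc by metis
  qed
  ultimately have ord: "3 \<le> ord s" by linarith
  \<comment> \<open>Otherwise the word of \<open>ord s\<close> copies of \<open>s\<close> is short
    enough to contain a smooth subword. All its letters are \<open>s\<close>, so its first corner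
    connects \<open>inv s\<close> with \<open>s\<close>.\<close>
  have "r < ord s"
  proof (rule ccontr)
    assume "\<not> r < ord s"
    then have "\<exists>a u b. replicate (ord s) s = a @ u @ b \<and> 2 \<le> length u \<and> wprod u = \<one> \<and> smooth u"
      using ord st sc by (intro smooth_subword) (auto simp: wprod_replicate)
    then obtain a u b where u: "replicate (ord s) s = a @ u @ b" "2 \<le> length u" "smooth u" by blast
    have "set u \<subseteq> set (replicate (ord s) s)" unfolding u(1) by auto
    then have "\<forall>x\<in>set u. x = s" by auto
    moreover have "0 < length u" using u(2) by auto
    ultimately have "u ! 0 = s" "u ! (1 mod length u) = s" by (meson nth_mem mod_less_divisor)+
    moreover have "conn (inv (u ! 0)) (u ! (1 mod length u))"
      using u(2,3) unfolding smooth_def by (metis One_nat_def not_numeral_le_zero gr_zeroI)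
    ultimately show False using st t conn_sym by auto
  qed
  moreover have "is_cycle_graph (carrier G) (cayley_adj G S) (ord s)"
    using power_cycle_graph[OF sc gen ord] S by simp
  moreover have "cyclic_group G"
    unfolding cyclic_group using generate_pow[OF sc] gen sc by auto
  ultimately show ?thesis by blast
qed

theorem theorem4p1:
  fixes G :: "('a, 'b) monoid_scheme" and S :: "'a set" and n r :: nat
  assumes "group G" and "finite (carrier G)"
    and "generating_set G S"
    and "n \<ge> 1" and "nilpotent_class_le G n"
    and "r \<ge> 2 ^ (n + 1)"
    and "\<exists>v. local_cutvertex (carrier G) (cayley_adj G S) r v"
  shows "(\<exists>m > r. is_cycle_graph (carrier G) (cayley_adj G S) m) \<and> cyclic_group G"
proof -
  obtain v where v: "local_cutvertex (carrier G) (cayley_adj G S) r v" using assms by blast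
  interpret cayley_ball G S r v
    using assms v by (intro cayley_ball.intro cayley_ball_axioms.intro) (auto simp: local_cutvertex_def)
  \<comment> \<open>The shift by one matches \<open>comm_word k\<close> with the commutator of index
    \<open>n\<close>, and \<open>2 ^ (k + 2)\<close> with \<open>2 ^ (n + 1)\<close>.\<close>
  obtain k where k: "n = Suc k" using assms(4) by (cases n) auto
  show ?thesis using cutvertex_imp_cycle[of k] assms v k by simp
qed

end
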